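(* Let $G$ be a finite bipartite graph with color classes $A$ and $B$, and let $b:V(G)\to\mathbb{Z}_{\ge0}$. Let $X_A$ (resp. $X_B$) be the union of the vertex sets of all inconsistent flexible components hooked up by $A$ (resp. by $B$). Then: (i) $(X_A\cap A)\cup(B\setminus X_A)$ and $(X_B\cap B)\cup(A\setminus X_B)$ are $b$-verifying sets; (ii) every $b$-verifying set $Z$ contains $(X_A\cap A)\cup(X_B\cap B)$ and is disjoint from $(X_A\cap B)\cup(X_B\cap A)$.
   Context: A $b$-matching is $M\subseteq E(G)$ with at most $b(v)$ edges of $M$ at each vertex $v$; maximum = largest cardinality; $v$ is $M$-loose if fewer than $b(v)$ edges of $M$ are incident with it. An edge is allowed if in some maximum $b$-matching, forbidden otherwise; an allowed edge is inevitable if in every maximum $b$-matching, flexible otherwise. Flexible components: induced subgraphs $G[V(K)]$, $K$ a connected component of $(V(G),\{\text{flexible edges}\})$. $\mathcal{D}$: vertices that are $M$-loose for some maximum $b$-matching $M$. A flexible component $C$ is loose if $V(C)\cap\mathcal{D}\ne\emptyset$. $v$ is inactive if $b(v)=0$, and then $G[\{v\}]$ is a flexible component called inactive. For $W\in\{A,B\}$, a flexible component $C$ is inconsistent hooked up by $W$ if $C$ is loose with $V(C)\cap\mathcal{D}\cap W\ne\emptyset$, or $C$ is inactive and its vertex has a neighbor in $\mathcal{D}\cap W$. For $Z\subseteq V(G)$, $E[Z]$ is the set of edges with both ends in $Z$ and $b(X)=\sum_{v\in X}b(v)$; $Z$ is a $b$-verifying set if $b(V(G)\setminus Z)+|E[Z]|$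 equals the size of a maximum $b$-matching. *)

theory Defs
  imports Main
begin

text \<open>
  Edges are identities of their own, so parallel edges are permitted; a simple graph is the
  special case in which \<open>ends\<close> is injective on the edges. Loops are excluded: they cannot
  occur in a bipartite graph.
\<close>

record ('v, 'e) graph =
  verts :: "'v set"
  edges :: "'e set"
  ends  :: "'e \<Rightarrow> 'v set"

definition finite_graph :: "('v, 'e) graph \<Rightarrow> bool" where
  "finite_graph G \<longleftrightarrow> finite (verts G) \<and> finite (edges G) \<and>
     (\<forall>e\<in>edges G. ends G e \<subseteq> verts G \<and> card (ends G e) = 2)"

definition color_classes :: "('v, 'e) graph \<Rightarrow> 'v set \<Rightarrow> 'v set \<Rightarrow> bool" where
  "color_classes G A B \<longleftrightarrow> A \<union> B = verts G \<and> A \<inter> B = {} \<and>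
     (\<forall>e\<in>edges G. \<exists>x\<in>A. \<exists>y\<in>B. ends G e = {x, y})"

definition neighbors :: "('v, 'e) graph \<Rightarrow> 'v \<Rightarrow> 'v set" where
  "neighbors G v = {u. \<exists>e\<in>edges G. ends G e = {v, u}}"

definition edges_within :: "('v, 'e) graph \<Rightarrow> 'v set \<Rightarrow> 'e set" where
  "edges_within G Z = {e \<in> edges G. ends G e \<subseteq> Z}"

definition induced_subgraph :: "('v, 'e) graph \<Rightarrow> 'v set \<Rightarrow> ('v, 'e) graph" where
  "induced_subgraph G U = G\<lparr>verts := U, edges := edges_within G U\<rparr>"

definition connection :: "('v, 'e) graph \<Rightarrow> ('v \<times> 'v) set" where
  "connection G = {(u, v) \<in> verts G \<times> verts G. (u, v) \<in> {(x, y). y \<in> neighbors G x}\<^sup>*}"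

definition connected_components :: "('v, 'e) graph \<Rightarrow> ('v, 'e) graph set" where
  "connected_components G = induced_subgraph G ` (verts G // connection G)"

definition incident_in :: "('v, 'e) graph \<Rightarrow> 'e set \<Rightarrow> 'v \<Rightarrow> 'e set" where
  "incident_in G M v = {e \<in> M. v \<in> ends G e}"

definition b_matching :: "('v, 'e) graph \<Rightarrow> ('v \<Rightarrow> nat) \<Rightarrow> 'e set \<Rightarrow> bool" where
  "b_matching G b M \<longleftrightarrow> M \<subseteq> edges G \<and> (\<forall>v\<in>verts G. card (incident_in G M v) \<le> b v)"

definition max_b_matching :: "('v, 'e) graph \<Rightarrow> ('v \<Rightarrow> nat) \<Rightarrow> 'e set \<Rightarrow> bool" where
  "max_b_matching G b M \<longleftrightarrow> b_matching G b M \<and> (\<forall>N. b_matching G b N \<longrightarrow> card N \<le> card M)"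

definition b_matching_number :: "('v, 'e) graph \<Rightarrow> ('v \<Rightarrow> nat) \<Rightarrow> nat" where
  "b_matching_number G b = Max (card ` {M. b_matching G b M})"

definition loose_vertex :: "('v, 'e) graph \<Rightarrow> ('v \<Rightarrow> nat) \<Rightarrow> 'e set \<Rightarrow> 'v \<Rightarrow> bool" where
  "loose_vertex G b M v \<longleftrightarrow> v \<in> verts G \<and> card (incident_in G M v) < b v"

definition D_set :: "('v, 'e) graph \<Rightarrow> ('v \<Rightarrow> nat) \<Rightarrow> 'v set" where
  "D_set G b = {v. \<exists>M. max_b_matching G b M \<and> loose_vertex G b M v}"

definition allowed_edge :: "('v, 'e) graph \<Rightarrow> ('v \<Rightarrow> nat) \<Rightarrow> 'e \<Rightarrow> bool" where
  "allowed_edge G b e \<longleftrightarrow> e \<in> edges G \<and> (\<exists>M. max_b_matching G b M \<and> e \<in> M)"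

definition inevitable_edge :: "('v, 'e) graph \<Rightarrow> ('v \<Rightarrow> nat) \<Rightarrow> 'e \<Rightarrow> bool" where
  "inevitable_edge G b e \<longleftrightarrow> allowed_edge G b e \<and> (\<forall>M. max_b_matching G b M \<longrightarrow> e \<in> M)"

definition flexible_edge :: "('v, 'e) graph \<Rightarrow> ('v \<Rightarrow> nat) \<Rightarrow> 'e \<Rightarrow> bool" where
  "flexible_edge G b e \<longleftrightarrow> allowed_edge G b e \<and> \<not> inevitable_edge G b e"

definition flexible_components :: "('v, 'e) graph \<Rightarrow> ('v \<Rightarrow> nat) \<Rightarrow> ('v, 'e) graph set" where
  "flexible_components G b =
     (\<lambda>K. induced_subgraph G (verts K)) `
       connected_components (G\<lparr>edges := {e. flexible_edge G b e}\<rparr>)"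

definition loose_component :: "('v, 'e) graph \<Rightarrow> ('v \<Rightarrow> nat) \<Rightarrow> ('v, 'e) graph \<Rightarrow> bool" where
  "loose_component G b C \<longleftrightarrow> C \<in> flexible_components G b \<and> verts C \<inter> D_set G b \<noteq> {}"

definition inactive_vertex :: "('v, 'e) graph \<Rightarrow> ('v \<Rightarrow> nat) \<Rightarrow> 'v \<Rightarrow> bool" where
  "inactive_vertex G b v \<longleftrightarrow> v \<in> verts G \<and> b v = 0"

definition inactive_component :: "('v, 'e) graph \<Rightarrow> ('v \<Rightarrow> nat) \<Rightarrow> ('v, 'e) graph \<Rightarrow> bool" where
  "inactive_component G b C \<longleftrightarrow> C \<in> flexible_components G b \<and>
     (\<exists>v. inactive_vertex G b v \<and> C = induced_subgraph G {v})"

definition inconsistent_hooked_up_by ::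
    "('v, 'e) graph \<Rightarrow> ('v \<Rightarrow> nat) \<Rightarrow> 'v set \<Rightarrow> ('v, 'e) graph \<Rightarrow> bool" where
  "inconsistent_hooked_up_by G b W C \<longleftrightarrow>
     (loose_component G b C \<and> verts C \<inter> D_set G b \<inter> W \<noteq> {}) \<or>
     (inactive_component G b C \<and> (\<exists>v\<in>verts C. neighbors G v \<inter> (D_set G b \<inter> W) \<noteq> {}))"

definition inconsistent_union :: "('v, 'e) graph \<Rightarrow> ('v \<Rightarrow> nat) \<Rightarrow> 'v set \<Rightarrow> 'v set" where
  "inconsistent_union G b W =
     (\<Union>C\<in>{C \<in> flexible_components G b. inconsistent_hooked_up_by G b W C}. verts C)"

definition b_verifying :: "('v, 'e) graph \<Rightarrow> ('v \<Rightarrow> nat) \<Rightarrow> 'v set \<Rightarrow> bool" where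
  "b_verifying G b Z \<longleftrightarrow> Z \<subseteq> verts G \<and>
     (\<Sum>v\<in>verts G - Z. b v) + card (edges_within G Z) = b_matching_number G b"

end

(*
  Fix a maximum b-matching M. Counting edges of M by their ends outside Z gives

    |M| + |M \<inter> E[V - Z]| + (sum over V - Z of b(v) - deg_M(v)) + |E[Z] - M| = b(V - Z) + |E[Z]|,

  so Z is b-verifying iff the three error terms vanish. Hence a b-verifying set Z contains the
  deficient set, and every flexible edge crosses Z; propagating this along flexible components
  gives (ii).

  For (i), let R be the set of vertices reachable by M-alternating walks (leaving A along edges
  outside M, leaving B along edges of M) from the M-loose vertices of A. Switching M along such
  walks shows that the three error terms vanish for (R \<inter> A) \<union> (B - R), which is
  Koenig's argument. Part (ii) applied to this set gives X_A \<subseteq> R, and one further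
  exchange gives R \<subseteq> X_A.
*)
theory Submission
  imports Defs
begin

section \<open>Maximum b-matchings and b-verifying sets\<close>

lemma max_b_matching_exists:
  assumes "finite_graph G"
  obtains M where "max_b_matching G b M"
proof -
  have fin: "finite (edges G)" using assms by (simp add: finite_graph_def)
  let ?S = "{M. b_matching G b M}"
  have "?S \<subseteq> Pow (edges G)" by (auto simp: b_matching_def)
  then have "finite ?S" using fin finite_subset by blast
  moreover have "{} \<in> ?S" by (simp add: b_matching_def incident_in_def)
  ultimately have "\<exists>M\<in>?S. card M = Max (card ` ?S)"
    by (metis (no_types, lifting) Max_in empty_iff finite_imageI image_iff image_is_empty)
  then obtain M where M: "M \<in> ?S" "card M = Max (card ` ?S)" by blast
  have "max_b_matching G b M"
    using M \<open>finite ?S\<close> by (auto simp: max_b_matching_def)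
  then show ?thesis by (rule that)
qed

lemma b_matching_number_eq:
  assumes "finite_graph G" and "max_b_matching G b M"
  shows "b_matching_number G b = card M"
proof -
  have "{M. b_matching G b M} \<subseteq> Pow (edges G)" by (auto simp: b_matching_def)
  then have "finite {M. b_matching G b M}"
    using assms(1) finite_subset by (fastforce simp: finite_graph_def)
  then show ?thesis unfolding b_matching_number_def
    using assms(2) by (intro Max_eqI) (auto simp: max_b_matching_def)
qed

text \<open>Double counting of the ends of \<open>M\<close>-edges outside \<open>Z\<close>. The
  truncated differences are exact because \<open>M\<close> is a b-matching.\<close>

lemma duality_gap:
  assumes G: "finite_graph G" and M: "b_matching G b M" and Z: "Z \<subseteq> verts G"
  shows "card M + card (M \<inter> edges_within G (verts G - Z))
           + (\<Sum>v\<in>verts G - Z. b v - card (incident_in G M v)) + card (edges_within G Z - M)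
         = (\<Sum>v\<in>verts G - Z. b v) + card (edges_within G Z)"
proof -
  let ?U = "verts G - Z" and ?E = "edges_within G"
  have finV: "finite ?U" and finE: "finite (edges G)" using G by (auto simp: finite_graph_def)
  have ME: "M \<subseteq> edges G" using M by (simp add: b_matching_def)
  have finM: "finite M" using ME finE finite_subset by blast
  have finEZ: "finite (?E Z)" using finE by (simp add: edges_within_def)
  \<comment> \<open>The first indicator counts an edge with at least one end outside
    \<open>Z\<close>; the second adds one more if both ends lie outside.\<close>
  have outside: "card {v \<in> ?U. v \<in> ends G e}
      = of_bool (e \<notin> ?E Z) + of_bool (e \<in> ?E ?U)" if "e \<in> M" for e
  proof -
    have e: "e \<in> edges G" using that ME by blast
    then obtain x y where xy: "ends G e = {x, y}" "x \<noteq> y"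
      using G by (auto simp: finite_graph_def card_2_iff)
    have V: "x \<in> verts G" "y \<in> verts G" using G e xy by (auto simp: finite_graph_def)
    have "{v \<in> ?U. v \<in> ends G e} = (if x \<in> Z then {} else {x}) \<union> (if y \<in> Z then {} else {y})"
      using xy V by auto
    then show ?thesis using xy V e by (auto simp: edges_within_def)
  qed
  have "(\<Sum>v\<in>?U. card (incident_in G M v)) = (\<Sum>v\<in>?U. \<Sum>e\<in>M. of_bool (v \<in> ends G e))"
    using finM by (simp add: incident_in_def sum.If_cases Int_def of_bool_def)
  also have "\<dots> = (\<Sum>e\<in>M. \<Sum>v\<in>?U. of_bool (v \<in> ends G e))" by (rule sum.swap)
  also have "\<dots> = (\<Sum>e\<in>M. card {v \<in> ?U. v \<in> ends G e})"
    using finV by (simp add: sum.If_cases Int_def of_bool_def)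
  also have "\<dots> = (\<Sum>e\<in>M. of_bool (e \<notin> ?E Z) + of_bool (e \<in> ?E ?U))"
    using outside by (intro sum.cong) auto
  also have "\<dots> = card (M - ?E Z) + card (M \<inter> ?E ?U)"
    using finM by (simp add: sum.distrib sum.If_cases Int_def of_bool_def set_diff_eq)
  finally have deg: "(\<Sum>v\<in>?U. card (incident_in G M v)) = card (M - ?E Z) + card (M \<inter> ?E ?U)" .
  have "(\<Sum>v\<in>?U. b v) = (\<Sum>v\<in>?U. (b v - card (incident_in G M v)) + card (incident_in G M v))"
    using M by (intro sum.cong) (auto simp: b_matching_def)
  then have bsum: "(\<Sum>v\<in>?U. b v)
      = (\<Sum>v\<in>?U. b v - card (incident_in G M v)) + (\<Sum>v\<in>?U. card (incident_in G M v))"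
    by (simp add: sum.distrib)
  have "card M = card (M \<inter> ?E Z) + card (M - ?E Z)"
    using card_Int_Diff finM by blast
  moreover have "card (?E Z) = card (M \<inter> ?E Z) + card (?E Z - M)"
    using card_Int_Diff[OF finEZ, of M] by (simp add: Int_commute)
  ultimately show ?thesis using deg bsum by linarith
qed

text \<open>Complementary slackness: the error terms of \<open>duality_gap\<close> must vanish. The
  left side does not mention \<open>M\<close>, so one maximum b-matching certifies \<open>Z\<close>,
  while a verifying \<open>Z\<close> constrains every maximum b-matching.\<close>

lemma b_verifying_iff:
  assumes G: "finite_graph G" and M: "max_b_matching G b M" and Z: "Z \<subseteq> verts G"
  shows "b_verifying G b Z \<longleftrightarrow>
    M \<inter> edges_within G (verts G - Z) = {} \<and> edges_within G Z \<subseteq> M \<and>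
    (\<forall>v\<in>verts G - Z. card (incident_in G M v) = b v)"
proof -
  have bM: "b_matching G b M" using M by (simp add: max_b_matching_def)
  have fin: "finite (verts G - Z)" "finite (edges G)" using G by (auto simp: finite_graph_def)
  then have "finite (M \<inter> edges_within G (verts G - Z))" "finite (edges_within G Z - M)"
    by (auto simp: edges_within_def)
  moreover have "b_verifying G b Z \<longleftrightarrow>
      card (M \<inter> edges_within G (verts G - Z)) = 0 \<and>
      (\<Sum>v\<in>verts G - Z. b v - card (incident_in G M v)) = 0 \<and> card (edges_within G Z - M) = 0"
    using duality_gap[OF G bM Z] Z unfolding b_verifying_def b_matching_number_eq[OF G M] by auto
  moreover have "(\<Sum>v\<in>verts G - Z. b v - card (incident_in G M v)) = 0 \<longleftrightarrow>
      (\<forall>v\<in>verts G - Z. card (incident_in G M v) = b v)"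
    using fin bM by (auto simp: b_matching_def intro: le_antisym)
  ultimately show ?thesis by auto
qed

section \<open>Flexible components\<close>

lemma flexible_edgeI:
  assumes "max_b_matching G b M" "e \<in> M" "max_b_matching G b N" "e \<notin> N"
  shows "flexible_edge G b e"
  using assms
  by (auto simp: flexible_edge_def allowed_edge_def inevitable_edge_def max_b_matching_def
      b_matching_def)

lemma flexible_edgeE:
  assumes "flexible_edge G b e"
  obtains M N where "max_b_matching G b M" "e \<in> M" "max_b_matching G b N" "e \<notin> N" "e \<in> edges G"
  using assms by (auto simp: flexible_edge_def allowed_edge_def inevitable_edge_def)

abbreviation flexible_connection :: "('v, 'e) graph \<Rightarrow> ('v \<Rightarrow> nat) \<Rightarrow> ('v \<times> 'v) set" where
  "flexible_connection G b \<equiv> connection (G\<lparr>edges := {e. flexible_edge G b e}\<rparr>)"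

lemma equiv_connection: "equiv (verts G) (connection G)"
proof (rule equivI)
  have "sym {(x, y). y \<in> neighbors G x}"
    by (auto simp: sym_def neighbors_def insert_commute)
  then show "sym (connection G)"
    using sym_rtrancl[of "{(x, y). y \<in> neighbors G x}"]
    by (auto simp: connection_def sym_def)
qed (auto simp: connection_def refl_on_def trans_def intro: rtrancl_trans)

text \<open>Reduces statements about whole flexible components to closure under a single flexible
  edge.\<close>

lemma flexible_connection_invariant:
  assumes closed: "\<And>e x y. flexible_edge G b e \<Longrightarrow> ends G e = {x, y} \<Longrightarrow> x \<in> S \<Longrightarrow> y \<in> S"
    and "(x, y) \<in> flexible_connection G b" and "x \<in> S"
  shows "y \<in> S"
proof -
  have "(x, y) \<in> {(x, y). y \<in> neighbors (G\<lparr>edges := {e. flexible_edge G b e}\<rparr>) x}\<^sup>*"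
    using assms(2) by (simp add: connection_def)
  then show ?thesis
    by (induction rule: rtrancl_induct)
      (use closed \<open>x \<in> S\<close> in \<open>auto simp: neighbors_def\<close>)
qed

lemma flexible_components_eq:
  "flexible_components G b
     = (\<lambda>v. induced_subgraph G (flexible_connection G b `` {v})) ` verts G"
  by (simp add: flexible_components_def connected_components_def quotient_def
      induced_subgraph_def image_image UNION_singleton_eq_range)

text \<open>No b-matching has an edge at \<open>v\<close>, so no flexible edge meets
  \<open>v\<close>. Its component is therefore the one-vertex subgraph that
  \<open>inactive_component\<close> asks for.\<close>

lemma inactive_flexible_class:
  assumes G: "finite_graph G" and v: "v \<in> verts G" "b v = 0"
  shows "flexible_connection G b `` {v} = {v}"
proof -
  have no_edge: False if fe: "flexible_edge G b e" and ends: "ends G e = {v, y}" for e y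
  proof -
    obtain M where M: "max_b_matching G b M" "e \<in> M"
      using fe by (rule flexible_edgeE)
    have bM: "b_matching G b M" using M by (simp add: max_b_matching_def)
    then have "card (incident_in G M v) = 0" using v unfolding b_matching_def by force
    moreover have "finite (incident_in G M v)"
      using bM G finite_subset by (fastforce simp: b_matching_def finite_graph_def incident_in_def)
    ultimately show False using M ends by (auto simp: incident_in_def)
  qed
  have "y = v" if "(v, y) \<in> flexible_connection G b" for y
    using flexible_connection_invariant[of G b "{v}" v y] that no_edge by blast
  then show ?thesis using v by (auto simp: connection_def)
qed

text \<open>Trades component subgraphs for a vertexwise description, the only form used from here
  on.\<close>

lemma mem_inconsistent_union_iff:
  assumes G: "finite_graph G"
  shows "x \<in> inconsistent_union G b W \<longleftrightarrow> x \<in> verts G \<and>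
    ((\<exists>d\<in>D_set G b \<inter> W. (d, x) \<in> flexible_connection G b) \<or>
     (b x = 0 \<and> neighbors G x \<inter> (D_set G b \<inter> W) \<noteq> {}))"
    (is "?L \<longleftrightarrow> ?R")
proof
  let ?r = "flexible_connection G b"
  have "equiv (verts (G\<lparr>edges := {e. flexible_edge G b e}\<rparr>)) ?r" by (rule equiv_connection)
  then have eq: "equiv (verts G) ?r" by simp
  have sub: "?r \<subseteq> verts G \<times> verts G" by (auto simp: connection_def)
  have sym: "(y, z) \<in> ?r \<Longrightarrow> (z, y) \<in> ?r" for y z using eq by (meson equivE symD)
  have trans: "(y, z) \<in> ?r \<Longrightarrow> (z, u) \<in> ?r \<Longrightarrow> (y, u) \<in> ?r" for y z u
    using eq by (meson equivE transD)
  {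
    assume ?L
    then obtain C where C: "C \<in> flexible_components G b" "inconsistent_hooked_up_by G b W C"
      and x: "x \<in> verts C" by (auto simp: inconsistent_union_def)
    then obtain v where v: "v \<in> verts G" "C = induced_subgraph G (?r `` {v})"
      by (auto simp: flexible_components_eq)
    then have vC: "verts C = ?r `` {v}" by (simp add: induced_subgraph_def)
    have xV: "x \<in> verts G" using x vC sub by auto
    from C(2) consider d where "d \<in> verts C" "d \<in> D_set G b \<inter> W"
      | "inactive_component G b C" "\<exists>v\<in>verts C. neighbors G v \<inter> (D_set G b \<inter> W) \<noteq> {}"
      by (auto simp: inconsistent_hooked_up_by_def)
    then show ?R
    proof cases
      case 1
      then have "(d, x) \<in> ?r" using x vC sym trans by blast
      then show ?thesis using 1 xV by blast
    next
      case 2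
      then obtain w where w: "inactive_vertex G b w" "C = induced_subgraph G {w}"
        unfolding inactive_component_def by blast
      then have "verts C = {w}" by (simp add: induced_subgraph_def)
      then show ?thesis using 2 w x xV by (auto simp: inactive_vertex_def)
    qed
  next
    assume R: ?R
    let ?C = "induced_subgraph G (?r `` {x})"
    have vC: "verts ?C = ?r `` {x}" by (simp add: induced_subgraph_def)
    have C: "?C \<in> flexible_components G b" using R by (auto simp: flexible_components_eq)
    have x: "x \<in> verts ?C" using R vC by (auto simp: connection_def)
    have "inconsistent_hooked_up_by G b W ?C"
    proof (cases "\<exists>d\<in>D_set G b \<inter> W. (d, x) \<in> ?r")
      case True
      then show ?thesis using C vC sym
        by (auto simp: inconsistent_hooked_up_by_def loose_component_def)
    next
      case False
      then have "b x = 0" "neighbors G x \<inter> (D_set G b \<inter> W) \<noteq> {}" "x \<in> verts G" using R by auto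
      then show ?thesis using C x inactive_flexible_class[of G x b, OF G]
        by (auto simp: inconsistent_hooked_up_by_def inactive_component_def inactive_vertex_def)
    qed
    then show ?L using C x by (auto simp: inconsistent_union_def)
  }
qed

section \<open>Bipartite graphs\<close>

text \<open>The results below treat hooking up by \<open>A\<close> only; interpreting the locale
  again with the color classes exchanged gives the case of \<open>B\<close>.\<close>

locale bipartite_graph =
  fixes G :: "('v, 'e) graph" and A B :: "'v set" and b :: "'v \<Rightarrow> nat"
  assumes finite_G: "finite_graph G" and classes: "color_classes G A B"
begin

abbreviation deg :: "'e set \<Rightarrow> 'v \<Rightarrow> nat" where
  "deg M v \<equiv> card (incident_in G M v)"

abbreviation max_matching :: "'e set \<Rightarrow> bool" where
  "max_matching M \<equiv> max_b_matching G b M"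

lemma verts_eq: "verts G = A \<union> B" and disjoint: "A \<inter> B = {}"
  using classes by (auto simp: color_classes_def)

lemma edge_ends:
  assumes "e \<in> edges G"
  obtains x y where "x \<in> A" "y \<in> B" "ends G e = {x, y}"
  using assms classes by (auto simp: color_classes_def)

lemma finite_edges: "finite (edges G)"
  using finite_G by (simp add: finite_graph_def)

lemma max_matching_subset: "max_matching M \<Longrightarrow> M \<subseteq> edges G"
  by (simp add: max_b_matching_def b_matching_def)

lemma max_matching_finite: "max_matching M \<Longrightarrow> finite M"
  using max_matching_subset finite_edges finite_subset by blast

lemma max_matching_deg_le: "max_matching M \<Longrightarrow> v \<in> verts G \<Longrightarrow> deg M v \<le> b v"
  by (simp add: max_b_matching_def b_matching_def)

section \<open>Degrees and exchanges of one or two edges\<close>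

lemma deg_insert:
  assumes "finite M" "e \<notin> M"
  shows "deg (insert e M) x = deg M x + of_bool (x \<in> ends G e)"
proof -
  have "incident_in G (insert e M) x
      = (if x \<in> ends G e then insert e (incident_in G M x) else incident_in G M x)"
    by (auto simp: incident_in_def)
  then show ?thesis using assms by (simp add: incident_in_def)
qed

text \<open>Written additively to avoid truncated subtraction; edges with common ends need no
  separate case.\<close>

lemma deg_exchange:
  assumes "finite M" "e \<notin> M" "f \<in> M"
  shows "deg (insert e (M - {f})) x + of_bool (x \<in> ends G f) = deg M x + of_bool (x \<in> ends G e)"
  using deg_insert[of "M - {f}" e x] deg_insert[of "M - {f}" f x] assms
  by (simp add: insert_absorb)

text \<open>Otherwise \<open>insert e M\<close> would be a larger b-matching.\<close>

lemma loose_neighbor_saturated: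
  assumes M: "max_matching M" and u: "loose_vertex G b M u"
    and e: "e \<in> edges G" "e \<notin> M" "ends G e = {u, v}"
  shows "deg M v = b v"
proof (rule ccontr)
  assume "deg M v \<noteq> b v"
  moreover have "v \<in> verts G" using e finite_G by (auto simp: finite_graph_def)
  ultimately have v: "deg M v < b v" using max_matching_deg_le[OF M] le_neq_implies_less by blast
  have finM: "finite M" using M by (rule max_matching_finite)
  have "b_matching G b (insert e M)"
    unfolding b_matching_def
  proof (intro conjI ballI)
    show "insert e M \<subseteq> edges G" using e max_matching_subset[OF M] by simp
    fix x assume "x \<in> verts G"
    then show "deg (insert e M) x \<le> b x"
      using deg_insert[OF finM e(2), of x] u v e(3) max_matching_deg_le[OF M, of x]
      by (auto simp: loose_vertex_def)
  qed
  then have "card (insert e M) \<le> card M" using M by (simp add: max_b_matching_def)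
  then show False using finM e by simp
qed

text \<open>With parallel edges \<open>w = s\<close> is possible; \<open>w\<close> is then loose because its degree is unchanged.\<close>

lemma exchange:
  assumes M: "max_matching M" and s: "loose_vertex G b M s"
    and e: "e \<in> edges G" "e \<notin> M" "ends G e = {s, v}" and f: "f \<in> M" "ends G f = {v, w}"
  shows "max_matching (insert e (M - {f}))" and "loose_vertex G b (insert e (M - {f})) w"
proof -
  let ?N = "insert e (M - {f})"
  have finM: "finite M" using M by (rule max_matching_finite)
  note deg = deg_exchange[OF finM e(2) f(1)]
  have fE: "f \<in> edges G" using f max_matching_subset[OF M] by blast
  have ne: "s \<noteq> v" "v \<noteq> w" using e f fE finite_G by (force simp: finite_graph_def)+
  have V: "s \<in> verts G" "v \<in> verts G" "w \<in> verts G"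
    using e f fE finite_G by (auto simp: finite_graph_def)
  \<comment> \<open>The degree of \<open>v\<close> is unchanged, since both edges meet it. Only
    \<open>s\<close> can gain an edge, and its looseness leaves room for one.\<close>
  have "b_matching G b ?N"
    unfolding b_matching_def
  proof (intro conjI ballI)
    show "?N \<subseteq> edges G" using e max_matching_subset[OF M] by auto
    fix x assume "x \<in> verts G"
    then show "deg ?N x \<le> b x"
      using deg[of x] s e f max_matching_deg_le[OF M, of x]
      by (auto simp: loose_vertex_def of_bool_def split: if_splits)
  qed
  moreover have "card ?N = card M"
    using finM e f card_gt_0_iff[of M] by (auto simp: card_insert_if card_Diff_singleton)
  ultimately show "max_matching ?N" using M by (auto simp: max_b_matching_def)
  show "loose_vertex G b ?N w"
    using deg[of w] s e f ne V max_matching_deg_le[OF M, of w]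
    by (auto simp: loose_vertex_def of_bool_def split: if_splits)
qed

section \<open>What an arbitrary verifying set must contain and avoid\<close>

text \<open>A flexible edge lies in one maximum b-matching, hence not in E[V - Z], and is missing
  from another, hence not in E[Z]. So it crosses \<open>Z\<close>, and its end in \<open>A\<close>
  lies in \<open>Z\<close> exactly when its end in \<open>B\<close> does not.\<close>

lemma verifying_flexible_closed:
  assumes Z: "b_verifying G b Z" and e: "flexible_edge G b e" "ends G e = {x, y}"
    and x: "x \<in> (Z \<inter> A) \<union> (B - Z)"
  shows "y \<in> (Z \<inter> A) \<union> (B - Z)"
proof -
  obtain M N where M: "max_matching M" "e \<in> M" and N: "max_matching N" "e \<notin> N"
    and eE: "e \<in> edges G" using e(1) by (rule flexible_edgeE)
  have ZV: "Z \<subseteq> verts G" using Z by (simp add: b_verifying_def)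
  have "e \<notin> edges_within G (verts G - Z)" "e \<notin> edges_within G Z"
    using Z M N b_verifying_iff[OF finite_G _ ZV] by blast+
  moreover obtain u v where "u \<in> A" "v \<in> B" "ends G e = {u, v}" using eE by (rule edge_ends)
  ultimately show ?thesis using x e(2) eE disjoint verts_eq
    by (auto simp: edges_within_def doubleton_eq_iff)
qed

lemma D_set_subset_verifying:
  assumes "b_verifying G b Z"
  shows "D_set G b \<subseteq> Z"
proof
  fix d assume "d \<in> D_set G b"
  then obtain M where M: "max_matching M" "loose_vertex G b M d" by (auto simp: D_set_def)
  have "Z \<subseteq> verts G" using assms by (simp add: b_verifying_def)
  then show "d \<in> Z" using assms b_verifying_iff[OF finite_G M(1)] M(2)
    by (fastforce simp: loose_vertex_def)
qed

text \<open>Used twice: for arbitrary \<open>Z\<close> it gives half of (ii), and for the set built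
  from alternating walks it gives one inclusion needed in (i).\<close>

lemma inconsistent_union_subset:
  assumes Z: "b_verifying G b Z"
  shows "inconsistent_union G b A \<subseteq> (Z \<inter> A) \<union> (B - Z)"
proof
  fix x assume "x \<in> inconsistent_union G b A"
  then consider d where "d \<in> D_set G b" "d \<in> A" "(d, x) \<in> flexible_connection G b"
    | d where "b x = 0" "x \<in> verts G" "d \<in> neighbors G x" "d \<in> D_set G b" "d \<in> A"
    using mem_inconsistent_union_iff[OF finite_G] by blast
  then show "x \<in> (Z \<inter> A) \<union> (B - Z)"
  proof cases
    case 1
    then have d: "d \<in> (Z \<inter> A) \<union> (B - Z)" using D_set_subset_verifying[OF Z] by blast
    show ?thesis
      by (rule flexible_connection_invariant[OF _ 1(3) d]) (rule verifying_flexible_closed[OF Z])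
  next
    case 2
    then obtain e where e: "e \<in> edges G" "ends G e = {x, d}" by (auto simp: neighbors_def)
    have xB: "x \<in> B" using e 2 disjoint by (elim edge_ends) (auto simp: doubleton_eq_iff)
    \<comment> \<open>An inactive \<open>x\<close> in \<open>Z\<close> would put the edge to
      \<open>d\<close> into E[Z], hence into every maximum b-matching, although
      \<open>b x = 0\<close>.\<close>
    have "x \<notin> Z"
    proof
      assume "x \<in> Z"
      then have eZ: "e \<in> edges_within G Z"
        using e 2 D_set_subset_verifying[OF Z] by (auto simp: edges_within_def)
      obtain M where M: "max_matching M" using max_b_matching_exists[OF finite_G] .
      have "Z \<subseteq> verts G" using Z by (simp add: b_verifying_def)
      then have "e \<in> M" using b_verifying_iff[OF finite_G M] Z eZ by blast
      then have "incident_in G M x \<noteq> {}" using e by (auto simp: incident_in_def)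
      then have "deg M x > 0"
        using max_matching_finite[OF M] by (simp add: card_gt_0_iff incident_in_def)
      then show False using max_matching_deg_le[OF M \<open>x \<in> verts G\<close>] 2 by simp
    qed
    then show ?thesis using xB by blast
  qed
qed

section \<open>Alternating walks\<close>

text \<open>The list records the vertices of \<open>B\<close> on an \<open>M\<close>-alternating walk between vertices of \<open>A\<close>.\<close>

inductive alternating_walk :: "'e set \<Rightarrow> 'v \<Rightarrow> 'v list \<Rightarrow> 'v \<Rightarrow> bool" for M where
  refl: "s \<in> A \<Longrightarrow> alternating_walk M s [] s"
| step: "\<lbrakk>s \<in> A; v \<in> B; e \<in> edges G; e \<notin> M; ends G e = {s, v}; f \<in> M; ends G f = {v, w};
    alternating_walk M w vs u\<rbrakk> \<Longrightarrow> alternating_walk M s (v # vs) u"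

lemma alternating_walk_ends:
  "alternating_walk M s vs u \<Longrightarrow> s \<in> A \<and> u \<in> A"
  by (induction rule: alternating_walk.induct) auto

lemma alternating_walk_snoc:
  assumes "alternating_walk M s vs u"
    and "v \<in> B" "e \<in> edges G" "e \<notin> M" "ends G e = {u, v}" "f \<in> M" "ends G f = {v, w}" "w \<in> A"
  shows "alternating_walk M s (vs @ [v]) w"
  using assms
  by (induction rule: alternating_walk.induct) (auto intro: alternating_walk.intros)

text \<open>Provides the shortcut for a walk that revisits \<open>v\<close>: the edge used to enter
  \<open>v\<close> first may be followed directly by this \<open>f\<close>.\<close>

lemma alternating_walk_suffix:
  assumes "alternating_walk M s vs u" "v \<in> set vs"
  obtains f w ws where "f \<in> M" "ends G f = {v, w}" "alternating_walk M w ws u"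
    "length ws < length vs"
  using assms
proof (induction arbitrary: thesis rule: alternating_walk.induct)
  case (step s v' e f w vs u)
  show ?case
  proof (cases "v = v'")
    case True
    then show ?thesis using step by auto
  next
    case False
    then have "v \<in> set vs" using step.prems by simp
    then show ?thesis using step.IH[OF step.prems(1)] by fastforce
  qed
qed auto

text \<open>Every edge of the walk has its end in \<open>B\<close> among \<open>vs\<close>, so it
  avoids \<open>v\<close> and keeps its status when only edges at \<open>v\<close> change.\<close>

lemma alternating_walk_switch:
  assumes "alternating_walk M s vs u" "v \<in> B" "v \<notin> set vs"
    and "\<And>e. v \<notin> ends G e \<Longrightarrow> e \<in> N \<longleftrightarrow> e \<in> M"
  shows "alternating_walk N s vs u"
  using assms
proof (induction rule: alternating_walk.induct)
  case (refl s)
  then show ?case by (intro alternating_walk.refl)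
next
  case (step s v' e f w vs u)
  have "w \<in> A" using step.hyps alternating_walk_ends by blast
  then have "v \<notin> ends G e" "v \<notin> ends G f" using step disjoint by auto
  then have "e \<notin> N" "f \<in> N" using step by blast+
  moreover have "alternating_walk N w vs u" using step by simp
  ultimately show ?case using step.hyps by (intro alternating_walk.step[of s v' e N f w]) auto
qed

text \<open>
  The induction switches the first two edges, both incident with the first \<open>B\<close>-vertex \<open>v\<close> of
  the walk. The remaining walk stays alternating unless it meets \<open>v\<close> again, in which case it
  can be shortened without switching.
\<close>

lemma alternating_walk_end:
  assumes "max_matching M" "loose_vertex G b M s" "alternating_walk M s vs u"
  shows "u \<in> D_set G b \<and>
    (\<forall>e v. e \<in> edges G \<longrightarrow> e \<notin> M \<longrightarrow> ends G e = {u, v} \<longrightarrow> deg M v = b v)"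
  using assms
proof (induction "length vs" arbitrary: M s vs rule: less_induct)
  case less
  from less.prems(3) show ?case
  proof cases
    case refl
    then show ?thesis using less.prems loose_neighbor_saturated
      by (auto simp: D_set_def)
  next
    case (step v e f w ws)
    show ?thesis
    proof (cases "v \<in> set ws")
      case True
      then obtain f' w' ws' where "f' \<in> M" "ends G f' = {v, w'}" "alternating_walk M w' ws' u"
        "length ws' < length ws" using step alternating_walk_suffix by metis
      then have "alternating_walk M s (v # ws') u" "length (v # ws') < length vs"
        using step by (auto intro: alternating_walk.step)
      then show ?thesis using less by blast
    next
      case False
      let ?N = "insert e (M - {f})"
      have N: "max_matching ?N" "loose_vertex G b ?N w"
        using exchange[OF less.prems(1,2)] step by auto
      have "alternating_walk ?N w ws u"
        by (rule alternating_walk_switch[where M = M and v = v]) (use step False in auto)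
      then have IH: "u \<in> D_set G b"
        "\<And>e' v'. e' \<in> edges G \<Longrightarrow> e' \<notin> ?N \<Longrightarrow> ends G e' = {u, v'} \<Longrightarrow> deg ?N v' = b v'"
        using less.hyps[OF _ N] step by auto
      \<comment> \<open>The induction hypothesis concerns \<open>?N\<close>, not \<open>M\<close>.
        Both exchanged edges have \<open>v\<close> as their only end in \<open>B\<close>, so any
        other \<open>v'\<close> keeps its degree and \<open>e'\<close> is not \<open>e\<close>;
        \<open>v\<close> itself is saturated because \<open>s\<close> is loose.\<close>
      have "deg M v' = b v'" if e': "e' \<in> edges G" "e' \<notin> M" "ends G e' = {u, v'}" for e' v'
      proof (cases "v' = v")
        case True
        then show ?thesis using loose_neighbor_saturated[OF less.prems(1,2)] step by blast
      next
        case False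
        have uA: "u \<in> A" and wA: "w \<in> A" using step alternating_walk_ends by blast+
        have v'B: "v' \<in> B" using e' uA disjoint
          by (elim edge_ends) (auto simp: doubleton_eq_iff)
        have "e' \<noteq> e" using e'(3) step False uA disjoint by (auto simp: doubleton_eq_iff)
        then have "deg ?N v' = b v'" using IH(2) e' by blast
        moreover have "v' \<notin> ends G e" "v' \<notin> ends G f" using v'B wA False step disjoint by auto
        ultimately show ?thesis
          using deg_exchange[of M e f v'] step max_matching_finite[OF less.prems(1)] by simp
      qed
      then show ?thesis using IH(1) by blast
    qed
  qed
qed

section \<open>The Koenig set and its identification with the inconsistent components\<close>

text \<open>If \<open>b v = 0\<close>, then \<open>v\<close> is inactive and adjacent to
  \<open>u\<close>. Otherwise \<open>e\<close> is flexible: \<open>M\<close> omits it, and a maximum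
  b-matching loose at \<open>u\<close> contains it or can be exchanged to contain it.\<close>

lemma neighbor_of_D_mem_inconsistent_union:
  assumes M: "max_matching M" and u: "u \<in> D_set G b" "u \<in> A"
    and e: "e \<in> edges G" "e \<notin> M" "ends G e = {u, v}"
  shows "v \<in> inconsistent_union G b A"
proof (cases "b v = 0")
  case True
  have "v \<in> verts G" using e finite_G by (auto simp: finite_graph_def)
  moreover have "u \<in> neighbors G v" using e by (auto simp: neighbors_def insert_commute)
  ultimately show ?thesis using True u mem_inconsistent_union_iff[OF finite_G] by blast
next
  case False
  obtain N where N: "max_matching N" "loose_vertex G b N u" using u by (auto simp: D_set_def)
  have "flexible_edge G b e"
  proof (cases "e \<in> N")
    case True
    show ?thesis by (rule flexible_edgeI[OF N(1) True M e(2)])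
  next
    case eN: False
    \<comment> \<open>Saturation with \<open>b v\<close> nonzero supplies an edge \<open>f\<close>
      at \<open>v\<close> to trade for \<open>e\<close>.\<close>
    have "deg N v > 0" using loose_neighbor_saturated[OF N e(1) eN e(3)] False by simp
    then obtain f where f: "f \<in> N" "v \<in> ends G f"
      by (auto simp: card_gt_0_iff incident_in_def)
    then have "f \<in> edges G" using max_matching_subset[OF N(1)] by blast
    then obtain x y where xy: "ends G f = {x, y}" by (rule edge_ends)
    obtain w where "ends G f = {v, w}"
      using that[of x] that[of y] f(2) xy by (auto simp: insert_commute)
    then have "max_matching (insert e (N - {f}))"
      by (rule exchange(1)[OF N e(1) eN e(3) f(1)])
    then show ?thesis by (rule flexible_edgeI[OF _ insertI1 M e(2)])
  qed
  then have "(u, v) \<in> flexible_connection G b"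
    using e finite_G by (auto simp: connection_def neighbors_def finite_graph_def)
  moreover have "v \<in> verts G" using e finite_G by (auto simp: finite_graph_def)
  ultimately show ?thesis using u mem_inconsistent_union_iff[OF finite_G] by blast
qed

lemma b_verifying_inconsistent_union:
  "b_verifying G b ((inconsistent_union G b A \<inter> A) \<union> (B - inconsistent_union G b A))"
proof -
  let ?X = "inconsistent_union G b A"
  obtain M where M: "max_matching M" using max_b_matching_exists[OF finite_G] .
  \<comment> \<open>\<open>RA\<close> and \<open>RB\<close> are the parts in \<open>A\<close> and
    \<open>B\<close> of the set reachable from the \<open>M\<close>-loose vertices of
    \<open>A\<close>.\<close>
  define RA where "RA = {u. \<exists>s vs. loose_vertex G b M s \<and> alternating_walk M s vs u}"
  define RB where "RB = {v \<in> B. \<exists>u e. u \<in> RA \<and> e \<in> edges G \<and> e \<notin> M \<and> ends G e = {u, v}}"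
  have RA: "RA \<subseteq> A" unfolding RA_def using alternating_walk_ends by blast
  have RA_D: "RA \<subseteq> D_set G b" unfolding RA_def using alternating_walk_end[OF M] by blast
  \<comment> \<open>Saturation is needed for the fixed \<open>M\<close>, while membership in
    \<open>D_set G b\<close> only makes the end of a walk loose for some maximum b-matching; hence
    the second conjunct of \<open>alternating_walk_end\<close>.\<close>
  have RB_saturated: "deg M v = b v" if "v \<in> RB" for v
    using that alternating_walk_end[OF M] unfolding RA_def RB_def by blast
  have loose_RA: "v \<in> RA" if "loose_vertex G b M v" "v \<in> A" for v
    using that alternating_walk.refl unfolding RA_def by blast
  have return_RA: "w \<in> RA" if "v \<in> RB" "f \<in> M" "ends G f = {v, w}" "w \<in> A" for v f w
    using that alternating_walk_snoc unfolding RA_def RB_def by blast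
  let ?Z = "RA \<union> (B - RB)"
  have RB: "RB \<subseteq> B" by (auto simp: RB_def)
  have ZV: "?Z \<subseteq> verts G" using RA verts_eq by auto
  have "M \<inter> edges_within G (verts G - ?Z) = {}"
  proof -
    have False if f: "f \<in> M" "ends G f \<subseteq> verts G - ?Z" for f
    proof -
      have "f \<in> edges G" using f max_matching_subset[OF M] by blast
      then obtain x y where xy: "x \<in> A" "y \<in> B" "ends G f = {x, y}" by (rule edge_ends)
      then have "y \<in> RB" "x \<notin> RA" using f(2) by auto
      then show False using return_RA[of y f x] f(1) xy by (simp add: insert_commute)
    qed
    then show ?thesis by (auto simp: edges_within_def)
  qed
  moreover have "edges_within G ?Z \<subseteq> M"
  proof
    fix e assume "e \<in> edges_within G ?Z"
    then have e: "e \<in> edges G" "ends G e \<subseteq> ?Z" by (auto simp: edges_within_def)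
    then obtain x y where xy: "x \<in> A" "y \<in> B" "ends G e = {x, y}" by (elim edge_ends)
    then have "x \<in> RA" "y \<notin> RB" using e(2) RA disjoint by auto
    then show "e \<in> M" using e(1) xy unfolding RB_def by blast
  qed
  moreover have "deg M v = b v" if v: "v \<in> verts G - ?Z" for v
  proof (cases "v \<in> B")
    case True
    then show ?thesis using v RB_saturated by blast
  next
    case False
    then have "v \<in> A" "v \<notin> RA" using v verts_eq by auto
    then have "\<not> loose_vertex G b M v" using loose_RA by blast
    then show ?thesis using v max_matching_deg_le[OF M, of v] by (auto simp: loose_vertex_def)
  qed
  ultimately have Z: "b_verifying G b ?Z" using b_verifying_iff[OF finite_G M ZV] by blast
  \<comment> \<open>For this \<open>?Z\<close>, the bound in
    \<open>inconsistent_union_subset\<close> is exactly \<open>RA\<close> together with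
    \<open>RB\<close>.\<close>
  have "?X \<subseteq> RA \<union> RB" using inconsistent_union_subset[OF Z] disjoint by blast
  moreover have "RB \<subseteq> ?X"
    using neighbor_of_D_mem_inconsistent_union[OF M] RA RA_D unfolding RB_def by blast
  moreover have "RA \<subseteq> ?X"
  proof
    fix u assume "u \<in> RA"
    then have "u \<in> D_set G b \<inter> A" "u \<in> verts G" using RA RA_D verts_eq by auto
    then show "u \<in> ?X" using mem_inconsistent_union_iff[OF finite_G, of u b A]
      by (auto simp: connection_def)
  qed
  ultimately have "(?X \<inter> A) \<union> (B - ?X) = ?Z" using RA RB disjoint by blast
  then show ?thesis using Z by simp
qed

end

theorem mainTheorem5:
  fixes G :: "('v, 'e) graph" and A B :: "'v set" and b :: "'v \<Rightarrow> nat"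
  assumes "finite_graph G" and "color_classes G A B"
  shows "(b_verifying G b ((inconsistent_union G b A \<inter> A) \<union> (B - inconsistent_union G b A)) \<and>
          b_verifying G b ((inconsistent_union G b B \<inter> B) \<union> (A - inconsistent_union G b B))) \<and>
         (\<forall>Z. b_verifying G b Z \<longrightarrow>
            (inconsistent_union G b A \<inter> A) \<union> (inconsistent_union G b B \<inter> B) \<subseteq> Z \<and>
            Z \<inter> ((inconsistent_union G b A \<inter> B) \<union> (inconsistent_union G b B \<inter> A)) = {})"
proof -
  interpret AB: bipartite_graph G A B b using assms by unfold_locales
  have "color_classes G B A"
    using assms(2) unfolding color_classes_def by (metis Int_commute Un_commute insert_commute)
  then interpret BA: bipartite_graph G B A b using assms(1) by unfold_locales
  \<comment> \<open>Part (ii) follows by intersecting the two inclusions, for \<open>A\<close> and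
    for \<open>B\<close>, with each color class.\<close>
  show ?thesis
    using AB.b_verifying_inconsistent_union BA.b_verifying_inconsistent_union
      AB.inconsistent_union_subset BA.inconsistent_union_subset AB.disjoint
    by blast
qed

end
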